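(* Let $n\ge2$, $m\ge2$ be integers and let $F_{n,m}$ be the Fermat hypersurface $$F_{n,m}=\{x_1^n+x_2^n+\dots+x_m^n=z^n\}$$ in $\mathbb{C}P^m$ with coordinates $x_1,\dots,x_m,z$. The projectively dual hypersurface is defined by the equation $$F_{n,m}^\vee=\{p_{n-1,m}(w^n;u_1^n,\dots,u_m^n)=0\}$$ in $(\mathbb{C}P^m)^\ast$ with dual coordinates $u_1,\dots,u_m,w$.
   Context: For integers $k\ge1$, $m\ge 2$ and $\varepsilon$ a primitive $k$-th root of unity, $$p_{k,m}(z;x_1,\dots,x_m)=\prod_{k_1,\dots,k_m=1}^{k}\bigl(\sqrt[k]{z}+\varepsilon^{k_1}\sqrt[k]{x_1}+\dots+\varepsilon^{k_m}\sqrt[k]{x_m}\bigr),$$ where a fixed branch of the $k$-th root is chosen; this is a symmetric polynomial in $z,x_1,\dots,x_m$. The projectively dual variety of $X\subset\mathbb{C}P^m$ is the closure in the dual space $(\mathbb{C}P^m)^\ast$ of the set of hyperplanes tangent to $X$ at its smooth points; $u_1,\dots,u_m,w$ are the coordinates on $(\mathbb{C}P^m)^\ast$ dual to $x_1,\dots,x_m,z$ respectively.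
   Formalization: The equation is corrected to p_{n-1,m}(-w^n; u_1^n,...,u_m^n)=0: with dual coordinates (hyperplane sum u_i x_i + wz = 0) the printed sign of w^n is wrong for every n; e.g. for n=2 the dual is sum u_i^2 = w^2, not sum u_i^2 + w^2 = 0. *)

theory Defs
  imports "HOL-Analysis.Analysis"
begin

text \<open>
  Complex projective space, as nonzero vectors modulo scaling. The index type \<open>'n\<close> enumerates the
  homogeneous coordinates, so the (complex) dimension is \<open>CARD('n) - 1\<close>. The value of \<open>proj\<close> at the
  zero vector is junk; every use below is guarded.
\<close>

definition proj_rel :: "complex ^ 'n \<Rightarrow> complex ^ 'n \<Rightarrow> bool" where
  "proj_rel v w \<longleftrightarrow> v \<noteq> 0 \<and> w \<noteq> 0 \<and> (\<exists>c. c \<noteq> 0 \<and> w = c *s v)"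

lemma part_equivp_proj_rel: "part_equivp (proj_rel :: complex ^ 'n \<Rightarrow> complex ^ 'n \<Rightarrow> bool)"
proof (rule part_equivpI)
  show "\<exists>v :: complex ^ 'n. proj_rel v v"
    by (rule exI[of _ 1]) (auto simp: proj_rel_def intro!: exI[of _ 1])
  show "symp (proj_rel :: complex ^ 'n \<Rightarrow> complex ^ 'n \<Rightarrow> bool)"
  proof (rule sympI)
    fix v w :: "complex ^ 'n"
    assume "proj_rel v w"
    then obtain c where "v \<noteq> 0" "w \<noteq> 0" "c \<noteq> 0" "w = c *s v"
      unfolding proj_rel_def by blast
    moreover from this have "v = inverse c *s w" by simp
    ultimately show "proj_rel w v"
      unfolding proj_rel_def by (metis nonzero_imp_inverse_nonzero)
  qed
  show "transp (proj_rel :: complex ^ 'n \<Rightarrow> complex ^ 'n \<Rightarrow> bool)"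
    unfolding proj_rel_def transp_def
    by (metis mult_eq_0_iff vector_smult_assoc)
qed

quotient_type 'n cproj = "complex ^ 'n" / partial: proj_rel
  morphisms rep_cproj proj
  by (rule part_equivp_proj_rel)

text \<open>The quotient topology from the nonzero vectors.\<close>

instantiation cproj :: (finite) topological_space
begin

definition open_cproj :: "'a cproj set \<Rightarrow> bool" where
  "open_cproj U \<longleftrightarrow> open {v. v \<noteq> 0 \<and> proj v \<in> U}"

instance
proof
  show "open (UNIV :: 'a cproj set)"
    unfolding open_cproj_def by (simp add: open_Collect_neq)
next
  fix S T :: "'a cproj set"
  assume "open S" "open T"
  then have "open ({v. v \<noteq> 0 \<and> proj v \<in> S} \<inter> {v. v \<noteq> 0 \<and> proj v \<in> T})"
    unfolding open_cproj_def by (rule open_Int)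
  also have "{v. v \<noteq> 0 \<and> proj v \<in> S} \<inter> {v. v \<noteq> 0 \<and> proj v \<in> T} = {v. v \<noteq> 0 \<and> proj v \<in> S \<inter> T}"
    by blast
  finally show "open (S \<inter> T)"
    unfolding open_cproj_def .
next
  fix K :: "'a cproj set set"
  assume "\<forall>S\<in>K. open S"
  then have "open (\<Union>S\<in>K. {v. v \<noteq> 0 \<and> proj v \<in> S})"
    unfolding open_cproj_def by (intro open_UN) auto
  also have "(\<Union>S\<in>K. {v. v \<noteq> 0 \<and> proj v \<in> S}) = {v. v \<noteq> 0 \<and> proj v \<in> \<Union>K}"
    by blast
  finally show "open (\<Union>K)"
    unfolding open_cproj_def .
qed

end

text \<open>
  Forms of degree \<open>d\<close>, as functions; \<open>\<alpha>\<close> runs over the (finitely many) exponent vectors of total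
  degree \<open>d\<close>.
\<close>

definition homogeneous_poly :: "nat \<Rightarrow> (complex ^ 'n \<Rightarrow> complex) \<Rightarrow> bool" where
  "homogeneous_poly d f \<longleftrightarrow>
    (\<exists>c :: ('n \<Rightarrow> nat) \<Rightarrow> complex.
      f = (\<lambda>x. \<Sum>\<alpha> | (\<Sum>i\<in>UNIV. \<alpha> i) = d. c \<alpha> * (\<Prod>i\<in>UNIV. (x $ i) ^ \<alpha> i)))"

definition forms_vanishing_on :: "'n cproj set \<Rightarrow> (complex ^ 'n \<Rightarrow> complex) set" where
  "forms_vanishing_on X =
    {f. (\<exists>d. homogeneous_poly d f) \<and> (\<forall>x. x \<noteq> 0 \<and> proj x \<in> X \<longrightarrow> f x = 0)}"

definition cgrad :: "(complex ^ 'n \<Rightarrow> complex) \<Rightarrow> complex ^ 'n \<Rightarrow> complex ^ 'n" where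
  "cgrad f v = (\<chi> i. deriv (\<lambda>t. f (v + t *s axis i 1)) 0)"

definition linear_hyperplane :: "complex ^ 'n \<Rightarrow> (complex ^ 'n) set" where
  "linear_hyperplane u = {y. (\<Sum>i\<in>UNIV. u $ i * y $ i) = 0}"

text \<open>
  The tangent space of the affine cone over \<open>X\<close> at \<open>v\<close>; its projectivization is the embedded
  projective tangent space of \<open>X\<close> at \<open>proj v\<close>.
\<close>

definition tangent_space :: "'n cproj set \<Rightarrow> complex ^ 'n \<Rightarrow> (complex ^ 'n) set" where
  "tangent_space X v = (\<Inter>f\<in>forms_vanishing_on X. linear_hyperplane (cgrad f v))"

text \<open>
  Jacobian criterion: near \<open>proj v\<close>, the set \<open>X\<close> is cut out by finitely many forms from its ideal
  whose differentials at \<open>v\<close> are linearly independent. By homogeneity this, like \<open>tangent_space\<close>,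
  depends only on \<open>proj v\<close>.
\<close>

definition smooth_point :: "'n::finite cproj set \<Rightarrow> complex ^ 'n \<Rightarrow> bool" where
  "smooth_point X v \<longleftrightarrow> v \<noteq> 0 \<and> proj v \<in> X \<and>
    (\<exists>G \<subseteq> forms_vanishing_on X. finite G \<and>
      inj_on (\<lambda>f. cgrad f v) G \<and> vec.independent ((\<lambda>f. cgrad f v) ` G) \<and>
      (\<exists>U. open U \<and> proj v \<in> U \<and>
        (\<forall>x. x \<noteq> 0 \<and> proj x \<in> U \<longrightarrow> (proj x \<in> X \<longleftrightarrow> (\<forall>f\<in>G. f x = 0)))))"

text \<open>
  The dual projective space is identified with \<open>'n cproj\<close> through the dual coordinates: \<open>proj u\<close>
  stands for the hyperplane with equation \<open>\<Sum>i. u\<^sub>i x\<^sub>i = 0\<close>. The closure is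
  taken in the classical topology; as the set of tangent hyperplanes is constructible, this is also
  its Zariski closure.
\<close>

definition dual_variety :: "'n::finite cproj set \<Rightarrow> 'n cproj set" where
  "dual_variety X =
    closure {proj u | u. u \<noteq> 0 \<and>
      (\<exists>v. smooth_point X v \<and> tangent_space X v \<subseteq> linear_hyperplane u)}"

text \<open>
  The coordinates \<open>x\<^sub>1, \<dots>, x\<^sub>m, z\<close> (and dually \<open>u\<^sub>1, \<dots>, u\<^sub>m, w\<close>) are indexed by \<open>'m option\<close>
  with \<open>m = CARD('m)\<close>: \<open>Some i\<close> for the first \<open>m\<close>, \<open>None\<close> for the last.
\<close>

definition fermat_hypersurface :: "nat \<Rightarrow> 'm::finite option cproj set" where
  "fermat_hypersurface n =
    {proj v | v. v \<noteq> 0 \<and> (\<Sum>i\<in>UNIV. (v $ Some i) ^ n) = (v $ None) ^ n}"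

definition primitive_root_of_unity :: "nat \<Rightarrow> complex \<Rightarrow> bool" where
  "primitive_root_of_unity k \<epsilon> \<longleftrightarrow> \<epsilon> ^ k = 1 \<and> (\<forall>j. 0 < j \<and> j < k \<longrightarrow> \<epsilon> ^ j \<noteq> 1)"

text \<open>No continuity is asked of a branch, so every choice of roots is covered.\<close>

definition root_branch :: "nat \<Rightarrow> (complex \<Rightarrow> complex) \<Rightarrow> bool" where
  "root_branch k \<rho> \<longleftrightarrow> (\<forall>z. \<rho> z ^ k = z)"

text \<open>
  The polynomial \<open>p\<^sub>k\<^sub>,\<^sub>m(z; x\<^sub>1, \<dots>, x\<^sub>m)\<close> with \<open>m = CARD('m)\<close>, for a primitive root of unity \<open>\<epsilon>\<close>
  and a branch \<open>\<rho>\<close> of the \<open>k\<close>-th root. The factors only involve \<open>+\<close>, whereas the last entry of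
  the gradient of \<open>x\<^sub>1\<^sup>n + \<dots> + x\<^sub>m\<^sup>n - z\<^sup>n\<close> is negative; with the pairing
  \<open>u\<^sub>1 x\<^sub>1 + \<dots> + u\<^sub>m x\<^sub>m + w z\<close> the dual of that hypersurface is therefore the zero set of
  \<open>p\<^sub>k\<^sub>,\<^sub>m(- w\<^sup>n; u\<^sub>1\<^sup>n, \<dots>, u\<^sub>m\<^sup>n)\<close>, \<open>k = n - 1\<close>, with a minus sign. (For \<open>n = 2\<close> it is the
  quadric \<open>u\<^sub>1\<^sup>2 + \<dots> + u\<^sub>m\<^sup>2 = w\<^sup>2\<close>, whereas \<open>p\<^sub>1\<^sub>,\<^sub>m(w\<^sup>2; u\<^sub>1\<^sup>2, \<dots>, u\<^sub>m\<^sup>2) = w\<^sup>2 + u\<^sub>1\<^sup>2 + \<dots> + u\<^sub>m\<^sup>2\<close>.)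
\<close>

definition p_poly ::
  "complex \<Rightarrow> (complex \<Rightarrow> complex) \<Rightarrow> nat \<Rightarrow> complex \<Rightarrow> ('m::finite \<Rightarrow> complex) \<Rightarrow> complex" where
  "p_poly \<epsilon> \<rho> k z x =
    (\<Prod>\<kappa> | \<forall>i. \<kappa> i \<in> {1..k}. \<rho> z + (\<Sum>i\<in>UNIV. \<epsilon> ^ \<kappa> i * \<rho> (x i)))"

end

theory Submission imports Defs begin

text \<open>
  Up to the factor \<open>n\<close> and with \<open>k = n - 1\<close>, the gradient of \<open>Q = x\<^sub>1\<^sup>n + \<dots> + x\<^sub>m\<^sup>n - z\<^sup>n\<close> is
  \<open>(x\<^sub>1\<^sup>k, \<dots>, x\<^sub>m\<^sup>k, - z\<^sup>k)\<close>, which vanishes only at the origin. So every point of the hypersurface is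
  smooth, and its tangent hyperplane there has these dual coordinates: the dual is the image of the
  hypersurface under this Gauss map. Everything up to this point works for any diagonal form
  \<open>\<Sum>i. s\<^sub>i x\<^sub>i\<^sup>n\<close> with nonzero coefficients and any number of variables, and is proved in that
  generality (\<open>dual_variety_diagonal_hypersurface\<close>).

  Two points need care. The tangent space is cut out by the differentials of all forms that vanish
  on the hypersurface, not just of \<open>Q\<close>; instead of identifying the vanishing ideal, every
  vector annihilated by the gradient of \<open>Q\<close> is realised as the velocity of a holomorphic curve
  inside the cone (\<open>diagonal_hypersurface_curve\<close>), and differentiating any vanishing form along that
  curve gives zero (\<open>tangent_space_diagonal_hypersurface\<close>). The dual is defined as a closure; the
  Gauss map is proper on the affine cone, hence its image is already closed
  (\<open>closed_gauss_map_image\<close>).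

  It remains to eliminate the point from \<open>u\<^sub>i = x\<^sub>i\<^sup>k\<close>, \<open>w = - z\<^sup>k\<close>, \<open>\<Sum>i. x\<^sub>i\<^sup>n = z\<^sup>n\<close>. The pairs
  \<open>(a, t)\<close> with \<open>t\<^sup>k = a\<^sup>n\<close> are exactly the pairs \<open>(x\<^sup>k, x\<^sup>n)\<close>, with \<open>x = t / a\<close> away from the origin
  (\<open>power_eq_power_Suc_iff\<close>). So such a point exists if and only if some \<open>k\<close>-th roots of
  \<open>u\<^sub>1\<^sup>n, \<dots>, u\<^sub>m\<^sup>n, - w\<^sup>n\<close> have sum zero, and the vanishing of one of the factors of \<open>p\<^sub>k\<^sub>,\<^sub>m\<close> says
  just this (\<open>p_poly_eq_0_iff\<close>).
\<close>

section \<open>Points of projective space\<close>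

lemma proj_eq_iff:
  assumes "v \<noteq> 0" "w \<noteq> 0"
  shows "proj v = proj w \<longleftrightarrow> (\<exists>c. c \<noteq> 0 \<and> w = c *s v)"
proof -
  have refl: "proj_rel x x" if "x \<noteq> 0" for x :: "complex ^ 'a"
    using that by (auto simp: proj_rel_def intro!: exI[of _ 1])
  have "proj_rel v w \<longleftrightarrow> proj v = proj w"
    using Quotient3_rel[OF Quotient3_cproj, of v w] refl assms by blast
  then show ?thesis
    using assms by (auto simp: proj_rel_def)
qed

lemma proj_mem_locus_iff:
  assumes "x \<noteq> 0" and cone: "\<And>c v. c \<noteq> 0 \<Longrightarrow> P v \<Longrightarrow> P (c *s v)"
  shows "proj x \<in> {proj v | v. v \<noteq> 0 \<and> P v} \<longleftrightarrow> P x"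
proof
  assume "proj x \<in> {proj v | v. v \<noteq> 0 \<and> P v}"
  then obtain v where v: "proj x = proj v" "v \<noteq> 0" "P v" by auto
  then obtain c where "c \<noteq> 0" "x = c *s v"
    using proj_eq_iff[OF v(2) assms(1)] by auto
  then show "P x" using cone v(3) by simp
qed (use assms in blast)

text \<open>
  The topology is the quotient of that of the punctured vector space, so a projective set is closed
  once its cone is; the apex may be included, as it is removed again by \<open>v \<noteq> 0\<close>.
\<close>

lemma closed_proj_locus:
  assumes "closed {v. P v}" and cone: "\<And>c v. c \<noteq> 0 \<Longrightarrow> P v \<Longrightarrow> P (c *s v)"
  shows "closed {proj v | v :: complex ^ 'n::finite. v \<noteq> 0 \<and> P v}"
proof -
  have "{v. v \<noteq> 0 \<and> proj v \<in> - {proj v | v. v \<noteq> 0 \<and> P v}} = - {v. P v} \<inter> {v. v \<noteq> 0}"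
    using proj_mem_locus_iff[of _ P] cone by auto
  moreover have "open (- {v. P v} \<inter> {v. v \<noteq> 0})"
    using assms(1) by (intro open_Int open_Collect_neq) (auto simp: open_Compl)
  ultimately show ?thesis
    unfolding closed_def open_cproj_def by simp
qed

text \<open>Two linear forms are proportional when the kernel of one contains that of the other.\<close>

lemma linear_hyperplane_subset_iff:
  fixes a u :: "complex ^ 'n::finite"
  assumes "a \<noteq> 0"
  shows "linear_hyperplane a \<subseteq> linear_hyperplane u \<longleftrightarrow> (\<exists>c. u = c *s a)"
proof
  assume sub: "linear_hyperplane a \<subseteq> linear_hyperplane u"
  obtain i where i: "a $ i \<noteq> 0" using assms by (auto simp: vec_eq_iff)
  have "u $ j * a $ i = u $ i * a $ j" for j
  proof (cases "j = i")
    case False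
    define y where "y = a $ i *s axis j 1 - a $ j *s axis i 1"
    have sum: "(\<Sum>l\<in>UNIV. b $ l * y $ l) = b $ j * a $ i - b $ i * a $ j" for b :: "complex ^ 'n"
    proof -
      have "b $ l * y $ l = (if l = j then b $ j * a $ i else 0) - (if l = i then b $ i * a $ j else 0)"
        for l using False by (auto simp: y_def axis_def)
      then show ?thesis by (simp add: sum_subtractf)
    qed
    have "y \<in> linear_hyperplane a" by (simp add: linear_hyperplane_def sum)
    then have "y \<in> linear_hyperplane u" using sub by blast
    then show ?thesis by (simp add: linear_hyperplane_def sum)
  qed simp
  then have "u = (u $ i / a $ i) *s a"
    using i by (simp add: vec_eq_iff field_simps)
  then show "\<exists>c. u = c *s a" by blast
next
  assume "\<exists>c. u = c *s a"
  then show "linear_hyperplane a \<subseteq> linear_hyperplane u"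
    by (auto simp: linear_hyperplane_def mult.assoc simp flip: sum_distrib_left)
qed

section \<open>Differentiating forms along curves\<close>

text \<open>
  A complex chain rule for curves through \<open>v\<close>. It determines \<open>D\<close> as the complex gradient
  (\<open>cgrad_eqI\<close>), and unlike the mere existence of partial derivatives it is preserved by sums and
  products, hence holds for every form.
\<close>

definition derivative_along_curves ::
  "(complex ^ 'n \<Rightarrow> complex) \<Rightarrow> complex ^ 'n::finite \<Rightarrow> complex ^ 'n \<Rightarrow> bool" where
  "derivative_along_curves f v D \<longleftrightarrow>
    (\<forall>\<gamma> y. \<gamma> 0 = v \<and> (\<forall>i. ((\<lambda>t. \<gamma> t $ i) has_field_derivative y $ i) (at 0)) \<longrightarrow>
      ((\<lambda>t. f (\<gamma> t)) has_field_derivative (\<Sum>i\<in>UNIV. D $ i * y $ i)) (at 0))"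

lemma derivative_along_curvesD:
  assumes "derivative_along_curves f v D" "\<gamma> 0 = v"
    and "\<And>i. ((\<lambda>t. \<gamma> t $ i) has_field_derivative y $ i) (at 0)"
  shows "((\<lambda>t. f (\<gamma> t)) has_field_derivative (\<Sum>i\<in>UNIV. D $ i * y $ i)) (at 0)"
  using assms unfolding derivative_along_curves_def by blast

lemma derivative_along_curves_const: "derivative_along_curves (\<lambda>x. c) v 0"
  by (simp add: derivative_along_curves_def)

lemma derivative_along_curves_component: "derivative_along_curves (\<lambda>x. x $ i) v (axis i 1)"
  by (simp add: derivative_along_curves_def axis_def if_distrib if_distribR sum.delta cong: if_cong)

lemma derivative_along_curves_add:
  assumes "derivative_along_curves f v D" "derivative_along_curves g v E"
  shows "derivative_along_curves (\<lambda>x. f x + g x) v (D + E)"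
  unfolding derivative_along_curves_def
proof (intro allI impI, elim conjE)
  fix \<gamma> y
  assume "\<gamma> 0 = v" "\<forall>i. ((\<lambda>t. \<gamma> t $ i) has_field_derivative y $ i) (at 0)"
  then show "((\<lambda>t. f (\<gamma> t) + g (\<gamma> t)) has_field_derivative
      (\<Sum>i\<in>UNIV. (D + E) $ i * y $ i)) (at 0)"
    using assms[THEN derivative_along_curvesD, of \<gamma> y]
    by (auto intro!: derivative_eq_intros simp: algebra_simps sum.distrib)
qed

lemma derivative_along_curves_mult:
  assumes "derivative_along_curves f v D" "derivative_along_curves g v E"
  shows "derivative_along_curves (\<lambda>x. f x * g x) v (g v *s D + f v *s E)"
  unfolding derivative_along_curves_def
proof (intro allI impI, elim conjE)
  fix \<gamma> y
  assume "\<gamma> 0 = v" "\<forall>i. ((\<lambda>t. \<gamma> t $ i) has_field_derivative y $ i) (at 0)"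
  then show "((\<lambda>t. f (\<gamma> t) * g (\<gamma> t)) has_field_derivative
      (\<Sum>i\<in>UNIV. (g v *s D + f v *s E) $ i * y $ i)) (at 0)"
    using assms[THEN derivative_along_curvesD, of \<gamma> y]
    by (auto intro!: derivative_eq_intros simp: algebra_simps sum.distrib sum_distrib_left)
qed

lemma derivative_along_curves_power:
  assumes "derivative_along_curves f v D"
  shows "\<exists>E. derivative_along_curves (\<lambda>x. f x ^ k) v E"
proof (induction k)
  case 0
  show ?case using derivative_along_curves_const[of 1 v] by auto
next
  case (Suc k)
  then obtain E where "derivative_along_curves (\<lambda>x. f x ^ k) v E" by blast
  from derivative_along_curves_mult[OF assms this] show ?case by auto
qed

lemma derivative_along_curves_prod:
  assumes "\<And>i. i \<in> I \<Longrightarrow> \<exists>E. derivative_along_curves (f i) v E"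
  shows "\<exists>E. derivative_along_curves (\<lambda>x. \<Prod>i\<in>I. f i x) v E"
  using assms
proof (induction I rule: infinite_finite_induct)
  case (insert i I)
  then obtain D E where "derivative_along_curves (f i) v D"
    "derivative_along_curves (\<lambda>x. \<Prod>i\<in>I. f i x) v E" by (meson insertCI)
  from derivative_along_curves_mult[OF this] show ?case using insert(1,2) by auto
qed (auto intro: derivative_along_curves_const)

lemma derivative_along_curves_sum:
  assumes "\<And>i. i \<in> I \<Longrightarrow> \<exists>E. derivative_along_curves (f i) v E"
  shows "\<exists>E. derivative_along_curves (\<lambda>x. \<Sum>i\<in>I. f i x) v E"
  using assms
proof (induction I rule: infinite_finite_induct)
  case (insert i I)
  then obtain D E where "derivative_along_curves (f i) v D"
    "derivative_along_curves (\<lambda>x. \<Sum>i\<in>I. f i x) v E" by (meson insertCI)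
  from derivative_along_curves_add[OF this] show ?case using insert(1,2) by auto
qed (auto intro: derivative_along_curves_const)

lemma cgrad_eqI:
  assumes "derivative_along_curves f v D"
  shows "cgrad f v = D"
proof -
  have "deriv (\<lambda>t. f (v + t *s axis i 1)) 0 = D $ i" for i
  proof -
    have "((\<lambda>t. f (v + t *s axis i 1)) has_field_derivative
        (\<Sum>j\<in>UNIV. D $ j * axis i 1 $ j)) (at 0)"
      by (rule derivative_along_curvesD[OF assms])
        (auto intro!: derivative_eq_intros simp: axis_def)
    moreover have "(\<Sum>j\<in>UNIV. D $ j * axis i 1 $ j) = D $ i"
      by (simp add: axis_def if_distrib sum.delta cong: if_cong)
    ultimately show ?thesis by (simp add: DERIV_imp_deriv)
  qed
  then show ?thesis by (simp add: cgrad_def vec_eq_iff)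
qed

lemma homogeneous_poly_derivative_along_curves:
  assumes "homogeneous_poly d f"
  shows "derivative_along_curves f v (cgrad f v)"
proof -
  obtain c where f: "f = (\<lambda>x. \<Sum>\<alpha> | (\<Sum>i\<in>UNIV. \<alpha> i) = d. c \<alpha> * (\<Prod>i\<in>UNIV. (x $ i) ^ \<alpha> i))"
    using assms unfolding homogeneous_poly_def by blast
  have "\<exists>E. derivative_along_curves (\<lambda>x. c \<alpha> * (\<Prod>i\<in>UNIV. (x $ i) ^ \<alpha> i)) v E" for \<alpha>
  proof -
    have "\<exists>E. derivative_along_curves (\<lambda>x. \<Prod>i\<in>UNIV. (x $ i) ^ \<alpha> i) v E"
      by (rule derivative_along_curves_prod, rule derivative_along_curves_power,
          rule derivative_along_curves_component)
    then obtain E where "derivative_along_curves (\<lambda>x. \<Prod>i\<in>UNIV. (x $ i) ^ \<alpha> i) v E" ..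
    from derivative_along_curves_mult[OF derivative_along_curves_const this] show ?thesis ..
  qed
  then have "\<exists>E. derivative_along_curves f v E"
    unfolding f by (rule derivative_along_curves_sum)
  then show ?thesis using cgrad_eqI by metis
qed

section \<open>Diagonal hypersurfaces\<close>

definition diagonal_form :: "nat \<Rightarrow> ('n \<Rightarrow> complex) \<Rightarrow> complex ^ 'n::finite \<Rightarrow> complex" where
  "diagonal_form n s x = (\<Sum>i\<in>UNIV. s i * (x $ i) ^ n)"

definition diagonal_hypersurface :: "nat \<Rightarrow> ('n \<Rightarrow> complex) \<Rightarrow> 'n::finite cproj set" where
  "diagonal_hypersurface n s = {proj v | v. v \<noteq> 0 \<and> diagonal_form n s v = 0}"

text \<open>For \<open>k = n - 1\<close> this is the gradient of the diagonal form of degree \<open>n\<close>, without its factor \<open>n\<close>.\<close>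

definition gauss_map :: "nat \<Rightarrow> ('n \<Rightarrow> complex) \<Rightarrow> complex ^ 'n \<Rightarrow> complex ^ 'n::finite" where
  "gauss_map k s v = (\<chi> i. s i * (v $ i) ^ k)"

lemma diagonal_form_scale: "diagonal_form n s (c *s v) = c ^ n * diagonal_form n s v"
  by (simp add: diagonal_form_def sum_distrib_left power_mult_distrib algebra_simps)

lemma gauss_map_scale: "gauss_map k s (c *s v) = c ^ k *s gauss_map k s v"
  by (simp add: gauss_map_def vec_eq_iff power_mult_distrib)

lemma gauss_map_eq_0_iff:
  assumes "k \<ge> 1" "\<And>i. s i \<noteq> 0"
  shows "gauss_map k s v = 0 \<longleftrightarrow> v = 0"
  using assms by (auto simp: gauss_map_def vec_eq_iff)

lemma proj_mem_diagonal_hypersurface_iff: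
  assumes "x \<noteq> 0"
  shows "proj x \<in> diagonal_hypersurface n s \<longleftrightarrow> diagonal_form n s x = 0"
  unfolding diagonal_hypersurface_def
  using assms by (subst proj_mem_locus_iff) (auto simp: diagonal_form_scale)

lemma homogeneous_poly_diagonal_form:
  "homogeneous_poly n (diagonal_form n s :: complex ^ 'n::finite \<Rightarrow> complex)"
proof -
  define A where "A = {\<alpha> :: 'n \<Rightarrow> nat. (\<Sum>i\<in>UNIV. \<alpha> i) = n}"
  define e where "e = (\<lambda>i j :: 'n. if j = i then n else 0)"
  have "A \<subseteq> PiE UNIV (\<lambda>_. {..n})"
    by (auto simp: A_def intro: member_le_sum)
  then have fin: "finite A" by (rule finite_subset) (intro finite_PiE; simp)
  have e: "e i \<in> A" for i by (simp add: A_def e_def)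
  have prod: "(\<Prod>j\<in>UNIV. (x $ j) ^ e i j) = (x $ i) ^ n" for i and x :: "complex ^ 'n"
    by (simp add: e_def if_distrib[of "\<lambda>m. _ ^ m"] prod.delta cong: if_cong)
  have "diagonal_form n s x =
      (\<Sum>\<alpha>\<in>A. (\<Sum>i\<in>UNIV. if \<alpha> = e i then s i else 0) * (\<Prod>j\<in>UNIV. (x $ j) ^ \<alpha> j))" for x
  proof -
    have "diagonal_form n s x = (\<Sum>i\<in>UNIV. s i * (\<Prod>j\<in>UNIV. (x $ j) ^ e i j))"
      by (simp add: diagonal_form_def prod)
    also have "\<dots> = (\<Sum>i\<in>UNIV. \<Sum>\<alpha>\<in>A. if \<alpha> = e i then s i * (\<Prod>j\<in>UNIV. (x $ j) ^ \<alpha> j) else 0)"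
      using fin e by (simp add: sum.delta')
    also have "\<dots> = (\<Sum>\<alpha>\<in>A. \<Sum>i\<in>UNIV. if \<alpha> = e i then s i * (\<Prod>j\<in>UNIV. (x $ j) ^ \<alpha> j) else 0)"
      by (rule sum.swap)
    also have "\<dots> = (\<Sum>\<alpha>\<in>A. (\<Sum>i\<in>UNIV. if \<alpha> = e i then s i else 0) * (\<Prod>j\<in>UNIV. (x $ j) ^ \<alpha> j))"
      by (simp add: sum_distrib_right if_distrib if_distribR cong: if_cong)
    finally show ?thesis .
  qed
  then show ?thesis
    unfolding homogeneous_poly_def A_def
    by (intro exI[of _ "\<lambda>\<alpha>. \<Sum>i\<in>UNIV. if \<alpha> = e i then s i else 0"]) (rule ext)
qed

lemma diagonal_form_mem_forms_vanishing_on: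
  "diagonal_form n s \<in> forms_vanishing_on (diagonal_hypersurface n s)"
  using homogeneous_poly_diagonal_form proj_mem_diagonal_hypersurface_iff
  unfolding forms_vanishing_on_def by blast

lemma cgrad_diagonal_form:
  "cgrad (diagonal_form n s) v = of_nat n *s gauss_map (n - 1) s v"
  by (rule cgrad_eqI)
    (auto simp: derivative_along_curves_def diagonal_form_def gauss_map_def algebra_simps
      intro!: derivative_eq_intros)

text \<open>
  Choose a coordinate \<open>p\<close> with \<open>v\<^sub>p \<noteq> 0\<close>, move all others linearly with velocity \<open>y\<close>, and
  solve the equation for the remaining one. Its velocity is then forced by the linearised equation,
  and equals \<open>y\<^sub>p\<close> because \<open>y\<close> satisfies that equation.
\<close>

lemma diagonal_hypersurface_curve:
  fixes s :: "'n::finite \<Rightarrow> complex" and v y :: "complex ^ 'n"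
  assumes n: "n \<ge> 1" and s: "\<And>i. s i \<noteq> 0" and v: "v \<noteq> 0" "diagonal_form n s v = 0"
    and y: "y \<in> linear_hyperplane (gauss_map (n - 1) s v)"
  obtains \<gamma> where "\<gamma> 0 = v" "\<And>i. ((\<lambda>t. \<gamma> t $ i) has_field_derivative y $ i) (at 0)"
    "\<And>t. diagonal_form n s (\<gamma> t) = 0"
proof -
  obtain p where p: "v $ p \<noteq> 0" using v(1) by (auto simp: vec_eq_iff)
  have split: "(\<Sum>i\<in>UNIV. f i) = f p + (\<Sum>i\<in>UNIV - {p}. f i)" for f :: "'n \<Rightarrow> complex"
    by (simp add: sum.remove)
  \<comment> \<open>\<open>(\<gamma>\<^sub>p(t) / v\<^sub>p)\<^sup>n\<close> has to equal \<open>h t\<close>. As \<open>h 0 = 1\<close>, the principal \<open>n\<close>-th root is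
    holomorphic near there.\<close>
  define h where "h t = - (\<Sum>i\<in>UNIV - {p}. s i * (v $ i + t * y $ i) ^ n) / (s p * (v $ p) ^ n)" for t
  define \<gamma> where "\<gamma> t = (\<chi> i. if i = p then v $ p * h t powr (1 / of_nat n) else v $ i + t * y $ i)" for t
  have vp: "- (\<Sum>i\<in>UNIV - {p}. s i * (v $ i) ^ n) = s p * (v $ p) ^ n"
    using v(2) by (simp add: diagonal_form_def split neg_eq_iff_add_eq_0 add.commute)
  have h0: "h 0 = 1"
    using s p unfolding h_def mult_zero_left add_0_right vp by simp
  have rootn: "(h t powr (1 / of_nat n)) ^ n = h t" for t
    using n by (cases "h t = 0") (auto simp: powr_power)
  have "\<gamma> 0 = v" by (simp add: \<gamma>_def h0 vec_eq_iff)
  moreover have "diagonal_form n s (\<gamma> t) = 0" for t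
  proof -
    have "diagonal_form n s (\<gamma> t) =
        s p * (v $ p) ^ n * h t + (\<Sum>i\<in>UNIV - {p}. s i * (v $ i + t * y $ i) ^ n)"
      by (simp add: diagonal_form_def split \<gamma>_def power_mult_distrib rootn)
    also have "\<dots> = 0" using s p by (simp add: h_def)
    finally show ?thesis .
  qed
  moreover have "((\<lambda>t. \<gamma> t $ i) has_field_derivative y $ i) (at 0)" for i
  proof (cases "i = p")
    case True
    define w where "w = (\<Sum>i\<in>UNIV - {p}. s i * (v $ i) ^ (n - 1) * y $ i)"
    have "s p * (v $ p) ^ (n - 1) * y $ p = - w"
      using y unfolding linear_hyperplane_def gauss_map_def
      by (simp add: split w_def eq_neg_iff_add_eq_0)
    moreover have "(v $ p) ^ n = v $ p * (v $ p) ^ (n - 1)"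
      using n by (cases n) auto
    ultimately have w: "- of_nat n * w / (s p * (v $ p) ^ n) = of_nat n * y $ p / v $ p"
      using s p by (simp add: field_simps)
    have "((\<lambda>t. - (\<Sum>i\<in>UNIV - {p}. s i * (v $ i + t * y $ i) ^ n)) has_field_derivative
        - of_nat n * w) (at 0)"
      unfolding w_def
      by (auto intro!: derivative_eq_intros simp: sum_distrib_left algebra_simps sum_negf)
    then have "(h has_field_derivative - of_nat n * w / (s p * (v $ p) ^ n)) (at 0)"
      unfolding h_def by (rule DERIV_cdivide)
    then have dh: "(h has_field_derivative of_nat n * y $ p / v $ p) (at 0)"
      unfolding w .
    have "((\<lambda>t. h t powr (1 / of_nat n)) has_field_derivative
        (1 / of_nat n * h 0 powr (1 / of_nat n - 1)) * (of_nat n * y $ p / v $ p)) (at 0)"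
      by (rule DERIV_chain2[OF has_field_derivative_powr dh]) (simp add: h0)
    from DERIV_cmult[OF this, of "v $ p"] show ?thesis
      using n p True by (simp add: \<gamma>_def h0)
  next
    case False
    then show ?thesis by (auto simp: \<gamma>_def intro!: derivative_eq_intros)
  qed
  ultimately show ?thesis using that by blast
qed

text \<open>
  One inclusion holds because the diagonal form is itself a vanishing form. For the other, any
  vanishing form is constantly zero along the curves above, so its differential kills their
  velocities.
\<close>

lemma tangent_space_diagonal_hypersurface:
  fixes s :: "'n::finite \<Rightarrow> complex"
  assumes n: "n \<ge> 1" and s: "\<And>i. s i \<noteq> 0" and v: "v \<noteq> 0" "diagonal_form n s v = 0"
  shows "tangent_space (diagonal_hypersurface n s) v = linear_hyperplane (gauss_map (n - 1) s v)"
proof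
  have "tangent_space (diagonal_hypersurface n s) v \<subseteq>
      linear_hyperplane (of_nat n *s gauss_map (n - 1) s v)"
    using diagonal_form_mem_forms_vanishing_on[of n s] cgrad_diagonal_form[of n s v]
    unfolding tangent_space_def by (metis INF_lower)
  also have "\<dots> = linear_hyperplane (gauss_map (n - 1) s v)"
    using n by (auto simp: linear_hyperplane_def mult.assoc simp flip: sum_distrib_left)
  finally show "tangent_space (diagonal_hypersurface n s) v \<subseteq> \<dots>" .
next
  show "linear_hyperplane (gauss_map (n - 1) s v) \<subseteq> tangent_space (diagonal_hypersurface n s) v"
    unfolding tangent_space_def
  proof (intro subsetI INT_I)
    fix y f
    assume y: "y \<in> linear_hyperplane (gauss_map (n - 1) s v)"
      and f: "f \<in> forms_vanishing_on (diagonal_hypersurface n s)"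
    obtain \<gamma> where \<gamma>: "\<gamma> 0 = v" "\<And>i. ((\<lambda>t. \<gamma> t $ i) has_field_derivative y $ i) (at 0)"
      "\<And>t. diagonal_form n s (\<gamma> t) = 0"
      using diagonal_hypersurface_curve[where s = s, OF n s v y] by blast
    obtain d where "homogeneous_poly d f" using f unfolding forms_vanishing_on_def by blast
    then have deriv: "((\<lambda>t. f (\<gamma> t)) has_field_derivative (\<Sum>i\<in>UNIV. cgrad f v $ i * y $ i)) (at 0)"
      using derivative_along_curvesD homogeneous_poly_derivative_along_curves \<gamma>(1,2) by blast
    \<comment> \<open>A vanishing form is only known to vanish at nonzero vectors, so the curve has to be kept
      away from the origin.\<close>
    obtain p where "v $ p \<noteq> 0" using v(1) by (auto simp: vec_eq_iff)
    moreover have "((\<lambda>t. \<gamma> t $ p) \<longlongrightarrow> \<gamma> 0 $ p) (nhds 0)"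
      using DERIV_isCont[OF \<gamma>(2)[of p]] tendsto_at_iff_tendsto_nhds[of "\<lambda>t. \<gamma> t $ p" 0]
      by (simp add: isCont_def)
    ultimately have "\<forall>\<^sub>F t in nhds 0. \<gamma> t $ p \<noteq> 0"
      using \<gamma>(1) by (intro tendsto_imp_eventually_ne[where c = "v $ p"]) simp_all
    then have "\<forall>\<^sub>F t in nhds 0. f (\<gamma> t) = 0"
    proof (rule eventually_mono)
      fix t assume "\<gamma> t $ p \<noteq> 0"
      then have "\<gamma> t \<noteq> 0" by auto
      then show "f (\<gamma> t) = 0"
        using f \<gamma>(3) proj_mem_diagonal_hypersurface_iff unfolding forms_vanishing_on_def by blast
    qed
    then have "((\<lambda>t. f (\<gamma> t)) has_field_derivative 0) (at 0)"
      by (subst DERIV_cong_ev[OF refl _ refl, where g = "\<lambda>_. 0"]) auto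
    with deriv have "(\<Sum>i\<in>UNIV. cgrad f v $ i * y $ i) = 0" by (rule DERIV_unique)
    then show "y \<in> linear_hyperplane (cgrad f v)" by (simp add: linear_hyperplane_def)
  qed
qed

lemma smooth_point_diagonal_hypersurface_iff:
  fixes s :: "'n::finite \<Rightarrow> complex"
  assumes n: "n \<ge> 2" and s: "\<And>i. s i \<noteq> 0"
  shows "smooth_point (diagonal_hypersurface n s) v \<longleftrightarrow> v \<noteq> 0 \<and> diagonal_form n s v = 0"
proof
  assume "smooth_point (diagonal_hypersurface n s) v"
  then show "v \<noteq> 0 \<and> diagonal_form n s v = 0"
    using proj_mem_diagonal_hypersurface_iff unfolding smooth_point_def by blast
next
  assume v: "v \<noteq> 0 \<and> diagonal_form n s v = 0"
  then have "cgrad (diagonal_form n s) v \<noteq> 0"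
    using n s by (simp add: cgrad_diagonal_form gauss_map_eq_0_iff)
  then have "vec.independent ((\<lambda>f. cgrad f v) ` {diagonal_form n s})" by simp
  moreover have "\<forall>x. x \<noteq> 0 \<and> proj x \<in> UNIV \<longrightarrow>
      (proj x \<in> diagonal_hypersurface n s \<longleftrightarrow> (\<forall>f\<in>{diagonal_form n s}. f x = 0))"
    using proj_mem_diagonal_hypersurface_iff by blast
  moreover have "proj v \<in> diagonal_hypersurface n s"
    using v proj_mem_diagonal_hypersurface_iff by blast
  ultimately show "smooth_point (diagonal_hypersurface n s) v"
    using v diagonal_form_mem_forms_vanishing_on[of n s]
    unfolding smooth_point_def
    by (intro conjI exI[of _ "{diagonal_form n s}"] exI[of _ UNIV]) simp_all
qed

section \<open>The dual of a diagonal hypersurface\<close>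

text \<open>
  A bound on \<open>s\<^sub>i v\<^sub>i\<^sup>k\<close> bounds \<open>v\<^sub>i\<close>, so preimages of compact sets are compact, and a proper map is
  closed.
\<close>

lemma closed_gauss_map_image:
  fixes s :: "'n::finite \<Rightarrow> complex"
  assumes k: "k \<ge> 1" and s: "\<And>i. s i \<noteq> 0" and Z: "closed Z"
  shows "closed (gauss_map k s ` Z)"
proof -
  have cont: "continuous_on UNIV (gauss_map k s)"
    unfolding gauss_map_def by (intro continuous_intros)
  have "closedin (top_of_set UNIV) (gauss_map k s ` Z)"
  proof (rule proper_map)
    fix K :: "(complex ^ 'n) set"
    assume "compact K"
    then obtain R where R: "\<And>u. u \<in> K \<Longrightarrow> norm u \<le> R" and "closed K"
      using compact_imp_bounded compact_imp_closed bounded_iff by metis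
    have "norm v \<le> norm (\<chi> i. complex_of_real (1 + R / norm (s i)))"
      if v: "gauss_map k s v \<in> K" for v
    proof (rule norm_le_componentwise_cart)
      fix i
      have "norm (s i) * norm (v $ i) ^ k \<le> R"
        using Finite_Cartesian_Product.norm_nth_le[of "gauss_map k s v" i] R[OF v]
        by (simp add: gauss_map_def norm_mult norm_power)
      then have "norm (v $ i) ^ k \<le> R / norm (s i)"
        using s[of i] by (simp add: field_simps)
      moreover have "norm (v $ i) \<le> 1 + norm (v $ i) ^ k"
        using k self_le_power[of "norm (v $ i)" k]
        by (cases "norm (v $ i) \<ge> 1") (auto intro: add_increasing2)
      ultimately have "norm (v $ i) \<le> 1 + R / norm (s i)" by linarith
      then show "norm (v $ i) \<le> norm ((\<chi> i. complex_of_real (1 + R / norm (s i))) $ i)"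
        by (simp only: vec_lambda_beta norm_of_real)
    qed
    then have "bounded (UNIV \<inter> gauss_map k s -` K)"
      by (intro boundedI) auto
    moreover have "closed (UNIV \<inter> gauss_map k s -` K)"
      using cont \<open>closed K\<close> by (simp add: closed_vimage continuous_on_eq_continuous_at)
    ultimately show "compact (UNIV \<inter> gauss_map k s -` K)"
      by (simp add: compact_eq_bounded_closed)
  qed (use Z in auto)
  then show ?thesis by simp
qed

lemma exists_complex_root:
  assumes "k \<ge> 1"
  shows "\<exists>d :: complex. d ^ k = c"
  using assms by (intro exI[of _ "c powr (1 / of_nat k)"], cases "c = 0") (auto simp: powr_power)

text \<open>
  The cone over a hypersurface is mapped onto a full cone: a factor \<open>c\<close> can be absorbed by scaling
  the point by a \<open>k\<close>-th root of \<open>c\<close>. This includes \<open>c = 0\<close>.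
\<close>

lemma gauss_map_image_scale:
  assumes "k \<ge> 1" "u \<in> gauss_map k s ` {v. diagonal_form n s v = 0}"
  shows "c *s u \<in> gauss_map k s ` {v. diagonal_form n s v = 0}"
proof -
  obtain v where v: "u = gauss_map k s v" "diagonal_form n s v = 0" using assms(2) by auto
  obtain d where "d ^ k = c" using exists_complex_root[OF assms(1)] by blast
  then have "c *s u = gauss_map k s (d *s v)" by (simp add: v gauss_map_scale)
  then show ?thesis using v(2) by (auto simp: diagonal_form_scale)
qed

text \<open>
  Each tangent space being the kernel of the Gauss map's value, the only hyperplane containing it is
  that value up to scaling; the closure adds nothing because the image is closed.
\<close>

theorem dual_variety_diagonal_hypersurface:
  fixes s :: "'n::finite \<Rightarrow> complex"
  assumes n: "n \<ge> 2" and s: "\<And>i. s i \<noteq> 0"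
  shows "dual_variety (diagonal_hypersurface n s) =
    {proj u | u. u \<noteq> 0 \<and> u \<in> gauss_map (n - 1) s ` {v. diagonal_form n s v = 0}}"
proof -
  let ?C = "gauss_map (n - 1) s ` {v. diagonal_form n s v = 0}"
  have k: "n - 1 \<ge> 1" using n by simp
  have "(\<exists>v. smooth_point (diagonal_hypersurface n s) v \<and>
      tangent_space (diagonal_hypersurface n s) v \<subseteq> linear_hyperplane u) \<longleftrightarrow> u \<in> ?C"
    (is "?L \<longleftrightarrow> _") if u: "u \<noteq> 0" for u
  proof -
    have "?L \<longleftrightarrow> (\<exists>v. v \<noteq> 0 \<and> diagonal_form n s v = 0 \<and> (\<exists>c. u = c *s gauss_map (n - 1) s v))"
    proof -
      have "tangent_space (diagonal_hypersurface n s) v \<subseteq> linear_hyperplane u \<longleftrightarrow>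
          (\<exists>c. u = c *s gauss_map (n - 1) s v)" if v: "v \<noteq> 0" "diagonal_form n s v = 0" for v
      proof -
        have "gauss_map (n - 1) s v \<noteq> 0" using gauss_map_eq_0_iff[of "n - 1" s v] k s v(1) by simp
        moreover have "n \<ge> 1" using n by simp
        ultimately show ?thesis
          using tangent_space_diagonal_hypersurface[where s = s, OF _ s v]
            linear_hyperplane_subset_iff by metis
      qed
      then show ?thesis unfolding smooth_point_diagonal_hypersurface_iff[where s = s, OF n s] by blast
    qed
    also have "\<dots> \<longleftrightarrow> u \<in> ?C"
    proof
      assume "\<exists>v. v \<noteq> 0 \<and> diagonal_form n s v = 0 \<and> (\<exists>c. u = c *s gauss_map (n - 1) s v)"
      then show "u \<in> ?C" using gauss_map_image_scale[OF k] by blast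
    next
      assume "u \<in> ?C"
      then obtain v where "u = gauss_map (n - 1) s v" "diagonal_form n s v = 0" by auto
      moreover have "v \<noteq> 0" using u gauss_map_eq_0_iff[of "n - 1" s v] k s calculation(1) by blast
      ultimately show "\<exists>v. v \<noteq> 0 \<and> diagonal_form n s v = 0 \<and> (\<exists>c. u = c *s gauss_map (n - 1) s v)"
        by (intro exI[of _ v] conjI exI[of _ 1]) auto
    qed
    finally show ?thesis .
  qed
  then have "dual_variety (diagonal_hypersurface n s) = closure {proj u | u. u \<noteq> 0 \<and> u \<in> ?C}"
    unfolding dual_variety_def by (intro arg_cong[where f = closure]) blast
  moreover have "closed {proj u | u. u \<noteq> 0 \<and> u \<in> ?C}"
  proof (rule closed_proj_locus)
    have "closed {v. diagonal_form n s v = 0}"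
      unfolding diagonal_form_def by (intro closed_Collect_eq continuous_intros)
    then show "closed {u. u \<in> ?C}" using closed_gauss_map_image[where s = s, OF k s] by simp
  qed (use gauss_map_image_scale[OF k] in blast)
  ultimately show ?thesis by simp
qed

section \<open>The equation of the dual\<close>

text \<open>The listed powers are distinct, and \<open>z\<^sup>k = 1\<close> has only \<open>k\<close> solutions.\<close>

lemma primitive_root_of_unity_powers:
  assumes "k \<ge> 1" "primitive_root_of_unity k \<epsilon>"
  shows "{z. z ^ k = 1} = (\<lambda>j. \<epsilon> ^ j) ` {1..k}"
proof -
  have \<epsilon>: "\<epsilon> ^ k = 1" "\<And>j. 0 < j \<Longrightarrow> j < k \<Longrightarrow> \<epsilon> ^ j \<noteq> 1"
    using assms(2) unfolding primitive_root_of_unity_def by auto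
  have "\<epsilon> \<noteq> 0" using \<epsilon>(1) assms(1) by (auto simp: power_0_left)
  have "\<epsilon> ^ a \<noteq> \<epsilon> ^ b" if "a < b" "a \<in> {1..k}" "b \<in> {1..k}" for a b
  proof
    assume "\<epsilon> ^ a = \<epsilon> ^ b"
    also have "\<epsilon> ^ b = \<epsilon> ^ a * \<epsilon> ^ (b - a)" using that(1) by (simp flip: power_add)
    finally have "\<epsilon> ^ (b - a) = 1" using \<open>\<epsilon> \<noteq> 0\<close> by simp
    moreover have "0 < b - a" "b - a < k" using that by auto
    ultimately show False using \<epsilon>(2) by blast
  qed
  then have "inj_on (\<lambda>j. \<epsilon> ^ j) {1..k}" by (intro linorder_inj_onI) auto
  then have "card ((\<lambda>j. \<epsilon> ^ j) ` {1..k}) = k" by (simp add: card_image)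
  moreover have "(\<epsilon> ^ j) ^ k = 1" for j
    using \<epsilon>(1) by (metis mult.commute power_mult power_one)
  ultimately show ?thesis
    using assms(1) finite_roots_unity[of k, where 'a = complex] card_complex_roots_unity[of k]
    by (intro card_subset_eq[symmetric]) auto
qed

lemma root_iff_power_mult_root_branch:
  assumes k: "k \<ge> 1" and \<epsilon>: "primitive_root_of_unity k \<epsilon>" and \<rho>: "root_branch k \<rho>"
  shows "r ^ k = x \<longleftrightarrow> (\<exists>j\<in>{1..k}. r = \<epsilon> ^ j * \<rho> x)"
proof
  have \<rho>x: "\<rho> x ^ k = x" using \<rho> unfolding root_branch_def by blast
  have roots: "z ^ k = 1 \<longleftrightarrow> (\<exists>j\<in>{1..k}. z = \<epsilon> ^ j)" for z
    using primitive_root_of_unity_powers[OF k \<epsilon>] by blast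
  show "\<exists>j\<in>{1..k}. r = \<epsilon> ^ j * \<rho> x" if r: "r ^ k = x"
  proof (cases "x = 0")
    case True
    then show ?thesis using r \<rho>x k by (auto intro!: bexI[of _ 1])
  next
    case False
    then have "\<rho> x \<noteq> 0" using \<rho>x k by (auto simp: power_0_left)
    moreover have "(r / \<rho> x) ^ k = 1" using r \<rho>x False by (simp add: power_divide)
    ultimately show ?thesis using roots[of "r / \<rho> x"] by (auto simp: field_simps)
  qed
  show "r ^ k = x" if "\<exists>j\<in>{1..k}. r = \<epsilon> ^ j * \<rho> x"
  proof -
    from that obtain j where "j \<in> {1..k}" "r = \<epsilon> ^ j * \<rho> x" ..
    moreover from this(1) have "(\<epsilon> ^ j) ^ k = 1" using roots by blast
    ultimately show ?thesis using \<rho>x by (simp add: power_mult_distrib)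
  qed
qed

text \<open>
  The factors run over all choices of roots of the \<open>x\<^sub>i\<close>, but use only the one root \<open>\<rho> z\<close> of \<open>z\<close>.
  Any other root of \<open>z\<close> is equally good, since a vanishing sum may be multiplied by a root of unity.
  In particular the zero set depends neither on the branch nor on \<open>\<epsilon>\<close>.
\<close>

lemma p_poly_eq_0_iff:
  fixes x :: "'m::finite \<Rightarrow> complex"
  assumes k: "k \<ge> 1" and \<epsilon>: "primitive_root_of_unity k \<epsilon>" and \<rho>: "root_branch k \<rho>"
  shows "p_poly \<epsilon> \<rho> k z x = 0 \<longleftrightarrow>
    (\<exists>q r. q ^ k = z \<and> (\<forall>i. r i ^ k = x i) \<and> q + (\<Sum>i\<in>UNIV. r i) = 0)"
proof -
  have "{\<kappa> :: 'm \<Rightarrow> nat. \<forall>i. \<kappa> i \<in> {1..k}} = PiE UNIV (\<lambda>_. {1..k})" by auto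
  then have "finite {\<kappa> :: 'm \<Rightarrow> nat. \<forall>i. \<kappa> i \<in> {1..k}}" by (simp add: finite_PiE)
  then have "p_poly \<epsilon> \<rho> k z x = 0 \<longleftrightarrow>
      (\<exists>\<kappa>. (\<forall>i. \<kappa> i \<in> {1..k}) \<and> \<rho> z + (\<Sum>i\<in>UNIV. \<epsilon> ^ \<kappa> i * \<rho> (x i)) = 0)"
    unfolding p_poly_def by (subst prod_zero_iff) auto
  also have "\<dots> \<longleftrightarrow> (\<exists>r. (\<forall>i. r i ^ k = x i) \<and> \<rho> z + (\<Sum>i\<in>UNIV. r i) = 0)" (is "?L \<longleftrightarrow> ?R")
  proof
    assume ?L
    then obtain \<kappa> where "\<forall>i. \<kappa> i \<in> {1..k}" "\<rho> z + (\<Sum>i\<in>UNIV. \<epsilon> ^ \<kappa> i * \<rho> (x i)) = 0" by blast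
    then show ?R
      using root_iff_power_mult_root_branch[OF k \<epsilon> \<rho>]
      by (intro exI[of _ "\<lambda>i. \<epsilon> ^ \<kappa> i * \<rho> (x i)"]) blast
  next
    assume ?R
    then obtain r where r: "\<And>i. r i ^ k = x i" "\<rho> z + (\<Sum>i\<in>UNIV. r i) = 0" by blast
    have "\<forall>i. \<exists>j. j \<in> {1..k} \<and> r i = \<epsilon> ^ j * \<rho> (x i)"
      using root_iff_power_mult_root_branch[OF k \<epsilon> \<rho>] r(1) by blast
    then obtain \<kappa> where \<kappa>: "\<And>i. \<kappa> i \<in> {1..k} \<and> r i = \<epsilon> ^ \<kappa> i * \<rho> (x i)" by metis
    then have "(\<Sum>i\<in>UNIV. r i) = (\<Sum>i\<in>UNIV. \<epsilon> ^ \<kappa> i * \<rho> (x i))" by (intro sum.cong) auto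
    then show ?L using \<kappa> r(2) by (intro exI[of _ \<kappa>]) auto
  qed
  also have "\<dots> \<longleftrightarrow> (\<exists>q r. q ^ k = z \<and> (\<forall>i. r i ^ k = x i) \<and> q + (\<Sum>i\<in>UNIV. r i) = 0)"
    (is "?L \<longleftrightarrow> ?R")
  proof
    assume ?L
    then show ?R using \<rho> unfolding root_branch_def by blast
  next
    assume ?R
    then obtain q r where q: "q ^ k = z" and r: "\<And>i. r i ^ k = x i" "q + (\<Sum>i\<in>UNIV. r i) = 0"
      by blast
    obtain \<eta> where \<eta>: "\<eta> ^ k = 1" "\<rho> z = \<eta> * q"
    proof (cases "q = 0")
      case True
      then have "\<rho> z ^ k = 0" using q \<rho> k unfolding root_branch_def by (auto simp: power_0_left)
      then show ?thesis using that[of 1] True by simp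
    next
      case False
      then have "(\<rho> z / q) ^ k = 1"
        using q \<rho> unfolding root_branch_def by (auto simp: power_divide)
      then show ?thesis using that[of "\<rho> z / q"] False by simp
    qed
    have "\<rho> z + (\<Sum>i\<in>UNIV. \<eta> * r i) = \<eta> * (q + (\<Sum>i\<in>UNIV. r i))"
      by (simp add: \<eta> distrib_left sum_distrib_left)
    then show ?L
      using r \<eta>(1) by (intro exI[of _ "\<lambda>i. \<eta> * r i"]) (auto simp: power_mult_distrib)
  qed
  finally show ?thesis .
qed

text \<open>
  The cuspidal curve \<open>t\<^sup>k = a\<^bsup>k+1\<^esup>\<close> is parametrised by \<open>x \<mapsto> (x\<^sup>k, x\<^bsup>k+1\<^esup>)\<close>, with inverse \<open>t / a\<close>. At
  the cusp \<open>a = t = 0\<close>, the convention \<open>t / 0 = 0\<close> gives the right parameter.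
\<close>

lemma power_eq_power_Suc_iff:
  fixes a t :: complex
  assumes "k \<ge> 1"
  shows "t ^ k = a ^ Suc k \<longleftrightarrow> (\<exists>x. x ^ k = a \<and> x ^ Suc k = t)"
proof
  assume t: "t ^ k = a ^ Suc k"
  show "\<exists>x. x ^ k = a \<and> x ^ Suc k = t"
  proof (intro exI[of _ "t / a"] conjI)
    show 1: "(t / a) ^ k = a"
      using t assms by (cases "a = 0") (auto simp: power_divide power_0_left)
    have "a = 0 \<Longrightarrow> t = 0" using t by simp
    then show "(t / a) ^ Suc k = t"
      unfolding power_Suc 1 by (cases "a = 0") auto
  qed
next
  assume "\<exists>x. x ^ k = a \<and> x ^ Suc k = t"
  then show "t ^ k = a ^ Suc k" by (metis mult.commute power_mult)
qed

definition fermat_sign :: "'m option \<Rightarrow> complex" where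
  "fermat_sign i = (if i = None then - 1 else 1)"

lemma sum_UNIV_option:
  "(\<Sum>i\<in>UNIV. f i) = f None + (\<Sum>i\<in>UNIV. f (Some i))" for f :: "'m::finite option \<Rightarrow> complex"
  by (simp add: UNIV_option_conv sum.reindex)

lemma fermat_hypersurface_diagonal:
  "(fermat_hypersurface n :: 'm::finite option cproj set) = diagonal_hypersurface n fermat_sign"
  by (simp add: fermat_hypersurface_def diagonal_hypersurface_def diagonal_form_def
      sum_UNIV_option fermat_sign_def)

text \<open>
  Coordinatewise, the cuspidal parametrisation trades a point \<open>v\<close> over \<open>u\<close> for the values \<open>r\<^sub>i = v\<^sub>i\<^sup>n\<close>,
  in which the equation of the hypersurface becomes linear. For the last coordinate, with \<open>z\<close> the
  last entry of \<open>v\<close>, the parametrised pair is \<open>(- w, - q) = (z\<^sup>k, z\<^sup>n)\<close>.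
\<close>

lemma mem_fermat_gauss_map_image_iff:
  fixes u :: "complex ^ 'm::finite option"
  assumes k: "k \<ge> 1"
  shows "u \<in> gauss_map k fermat_sign ` {v. diagonal_form (Suc k) fermat_sign v = 0} \<longleftrightarrow>
    (\<exists>q r. q ^ k = - ((u $ None) ^ Suc k) \<and> (\<forall>i. r i ^ k = (u $ Some i) ^ Suc k) \<and>
      q + (\<Sum>i\<in>UNIV. r i) = 0)"
    (is "_ \<longleftrightarrow> ?R")
proof -
  \<comment> \<open>Since \<open>k\<close> and \<open>k + 1\<close> have opposite parity, exactly one of the two sides changes sign.\<close>
  have sign: "q ^ k = - (w ^ Suc k) \<longleftrightarrow> (- q) ^ k = (- w) ^ Suc k" for q w :: complex
    by (cases "even k") (simp_all add: eq_neg_iff_add_eq_0 neg_eq_iff_add_eq_0)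
  have "?R \<longleftrightarrow> (\<exists>q r. (\<exists>z. z ^ k = - (u $ None) \<and> z ^ Suc k = - q) \<and>
      (\<forall>i. \<exists>y. y ^ k = u $ Some i \<and> y ^ Suc k = r i) \<and> q + (\<Sum>i\<in>UNIV. r i) = 0)"
    unfolding sign power_eq_power_Suc_iff[OF k] ..
  also have "\<dots> \<longleftrightarrow> (\<exists>z y. z ^ k = - (u $ None) \<and> (\<forall>i. y i ^ k = u $ Some i) \<and>
      - (z ^ Suc k) + (\<Sum>i\<in>UNIV. y i ^ Suc k) = 0)"
    (is "?A \<longleftrightarrow> ?B")
  proof
    assume ?A
    then obtain q r z where z: "z ^ k = - (u $ None)" "z ^ Suc k = - q"
      and "\<forall>i. \<exists>y. y ^ k = u $ Some i \<and> y ^ Suc k = r i" and sum: "q + (\<Sum>i\<in>UNIV. r i) = 0"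
      by blast
    then obtain y where y: "\<And>i. y i ^ k = u $ Some i" "\<And>i. y i ^ Suc k = r i" by metis
    have "- (z ^ Suc k) + (\<Sum>i\<in>UNIV. y i ^ Suc k) = 0"
      unfolding z(2) y(2) using sum by simp
    then show ?B using z(1) y(1) by blast
  next
    assume ?B
    then obtain z y where "z ^ k = - (u $ None)" "\<forall>i. y i ^ k = u $ Some i"
      "- (z ^ Suc k) + (\<Sum>i\<in>UNIV. y i ^ Suc k) = 0" by blast
    then show ?A
      by (intro exI[of _ "- (z ^ Suc k)"] exI[of _ "\<lambda>i. y i ^ Suc k"]) auto
  qed
  also have "\<dots> \<longleftrightarrow> u \<in> gauss_map k fermat_sign ` {v. diagonal_form (Suc k) fermat_sign v = 0}"
    (is "_ \<longleftrightarrow> u \<in> ?C")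
  proof
    assume ?B
    then obtain z y where zy: "z ^ k = - (u $ None)" "\<And>i. y i ^ k = u $ Some i"
      "- (z ^ Suc k) + (\<Sum>i\<in>UNIV. y i ^ Suc k) = 0" by blast
    define v :: "complex ^ 'm option" where "v = (\<chi> i. case i of None \<Rightarrow> z | Some i \<Rightarrow> y i)"
    have "u = gauss_map k fermat_sign v"
      by (auto simp: vec_eq_iff gauss_map_def v_def fermat_sign_def zy(1,2) split: option.split)
    moreover have "diagonal_form (Suc k) fermat_sign v = 0"
      using zy(3) by (simp add: diagonal_form_def sum_UNIV_option v_def fermat_sign_def)
    ultimately show "u \<in> ?C" by blast
  next
    assume "u \<in> ?C"
    then obtain v where "u = gauss_map k fermat_sign v" "diagonal_form (Suc k) fermat_sign v = 0"
      by blast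
    then show ?B
      by (intro exI[of _ "v $ None"] exI[of _ "\<lambda>i. v $ Some i"])
        (auto simp: gauss_map_def diagonal_form_def sum_UNIV_option fermat_sign_def)
  qed
  finally show ?thesis by blast
qed

theorem theorem12:
  fixes n :: nat and \<epsilon> :: complex and \<rho> :: "complex \<Rightarrow> complex"
  assumes "n \<ge> 2"
    and "CARD('m::finite) \<ge> 2"
    and "primitive_root_of_unity (n - 1) \<epsilon>"
    and "root_branch (n - 1) \<rho>"
  shows "dual_variety (fermat_hypersurface n :: 'm option cproj set) =
    {proj v | v. v \<noteq> 0 \<and>
      p_poly \<epsilon> \<rho> (n - 1) (- ((v $ None) ^ n)) (\<lambda>i. (v $ Some i) ^ n) = 0}"
proof -
  have k: "n - 1 \<ge> 1" and n: "Suc (n - 1) = n" using assms(1) by auto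
  have "u \<in> gauss_map (n - 1) fermat_sign ` {v. diagonal_form n fermat_sign v = 0} \<longleftrightarrow>
      p_poly \<epsilon> \<rho> (n - 1) (- ((u $ None) ^ n)) (\<lambda>i. (u $ Some i) ^ n) = 0"
    for u :: "complex ^ 'm option"
    unfolding p_poly_eq_0_iff[OF k assms(3,4)]
    using mem_fermat_gauss_map_image_iff[OF k, of u] by (simp only: n)
  moreover have "fermat_sign i \<noteq> 0" for i :: "'m option"
    by (simp add: fermat_sign_def)
  ultimately show ?thesis
    unfolding fermat_hypersurface_diagonal
    by (simp add: dual_variety_diagonal_hypersurface[OF assms(1)])
qed

end
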